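(* Let $(V, V^+, \vert\cdot\vert)$ be an absolutely ordered space and let $u, v \in V$. Then the following statements are equivalent: (1) $u \perp v$; (2) $u^+, u^-, v^+, v^-$ are mutually orthogonal; (3) $\vert u + v \vert = \vert u \vert + \vert v \vert$ and $\vert u - v \vert = \vert u \vert + \vert v \vert$.
   Context: A real ordered vector space $(V,V^+)$ is a real vector space $V$ with a cone $V^+$ (closed under addition and multiplication by nonnegative scalars); $u \le v$ means $v-u \in V^+$. It is an absolutely ordered space if there is a map $\vert\cdot\vert : V \to V^+$ such that: (1) $\vert v\vert = v$ if $v \in V^+$; (2) $\vert v \vert \pm v \in V^+$ for all $v \in V$; (3) $\vert kv\vert = \vert k\vert \vert v\vert$ for all $v\in V$, $k \in \mathbb{R}$; (4) if $\vert u-v\vert = u+v$ and $0 \le w \le v$, then $\vert u-w\vert = u+w$; (5) if $\vert u-v\vert = u+v$ and $\vert u-w\vert = u+w$, then $\vert u - \vert v\pm w\vert\vert = u + \vert v \pm w\vert$. If $u,v\in V$ satisfy $\vert u-v\vert = u+v$, then automatically $u,v\in V^+$; for such positive $u,v$ one says $u$ is orthogonal to $v$ and writes $u\perp v$. For general $u,v\in V$, $u\perp v$ means $\vert\, \vert u\vert - \vert v\vert\, \vert = \vert u\vert + \vert v\vert$ (that is, $\vert u\vert \perp \vert v\vert$). For $v\in V$, $v^+ := \frac12(\vert v\vert + v)$ and $v^- := \frac12(\vert v\vert - v)$. "Mutually orthogonal" means pairwise orthogonal. *)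

theory Defs
  imports Complex_Main
begin

text \<open>The cone is not assumed to be proper, generating or nonempty. That it is nonempty and proper
  follows from the axioms of an absolutely ordered space.\<close>

locale real_ordered_vector_space =
  fixes P :: "'a::real_vector set"
  assumes cone_add: "u \<in> P \<Longrightarrow> v \<in> P \<Longrightarrow> u + v \<in> P"
    and cone_scaleR: "v \<in> P \<Longrightarrow> 0 \<le> (k::real) \<Longrightarrow> k *\<^sub>R v \<in> P"

definition cone_le :: "'a::real_vector set \<Rightarrow> 'a \<Rightarrow> 'a \<Rightarrow> bool" where
  "cone_le P u v \<longleftrightarrow> v - u \<in> P"

text \<open>The map \<open>A\<close> is the absolute value \<open>\<bar>\<cdot>\<bar>\<close> of the space; \<open>\<bar>k\<bar>\<close> for a scalar \<open>k\<close> is the usual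
  absolute value on the reals.\<close>

locale absolutely_ordered_space = real_ordered_vector_space P
  for P :: "'a::real_vector set" +
  fixes A :: "'a \<Rightarrow> 'a"
  assumes abs_mem: "A v \<in> P"
    and abs_of_pos: "v \<in> P \<Longrightarrow> A v = v"
    and abs_plus_mem: "A v + v \<in> P"
    and abs_minus_mem: "A v - v \<in> P"
    and abs_scaleR: "A (k *\<^sub>R v) = \<bar>k\<bar> *\<^sub>R A v"
    and abs_orth_le: "A (u - v) = u + v \<Longrightarrow> cone_le P 0 w \<Longrightarrow> cone_le P w v \<Longrightarrow> A (u - w) = u + w"
    and abs_orth_plus: "A (u - v) = u + v \<Longrightarrow> A (u - w) = u + w \<Longrightarrow>
           A (u - A (v + w)) = u + A (v + w)"
    and abs_orth_minus: "A (u - v) = u + v \<Longrightarrow> A (u - w) = u + w \<Longrightarrow>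
           A (u - A (v - w)) = u + A (v - w)"

definition abs_orthogonal :: "('a::real_vector \<Rightarrow> 'a) \<Rightarrow> 'a \<Rightarrow> 'a \<Rightarrow> bool" where
  "abs_orthogonal A u v \<longleftrightarrow> A (A u - A v) = A u + A v"

definition pos_part :: "('a::real_vector \<Rightarrow> 'a) \<Rightarrow> 'a \<Rightarrow> 'a" where
  "pos_part A v = (1/2) *\<^sub>R (A v + v)"

definition neg_part :: "('a::real_vector \<Rightarrow> 'a) \<Rightarrow> 'a \<Rightarrow> 'a" where
  "neg_part A v = (1/2) *\<^sub>R (A v - v)"

text \<open>Mutual orthogonality concerns a family rather than a set: entries at different positions
  have to be orthogonal even if they happen to be equal as vectors.\<close>

definition mutually_orthogonal :: "('a::real_vector \<Rightarrow> 'a) \<Rightarrow> 'a list \<Rightarrow> bool" where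
  "mutually_orthogonal A xs \<longleftrightarrow>
     (\<forall>i < length xs. \<forall>j < length xs. i \<noteq> j \<longrightarrow> abs_orthogonal A (xs ! i) (xs ! j))"

context absolutely_ordered_space
begin

text \<open>On the cone, the general definition of orthogonality agrees with the primary one,
  \<open>\<bar>u - v\<bar> = u + v\<close>, and that equation forces both vectors to be positive.\<close>

lemma abs_orthogonal_on_cone:
  assumes "u \<in> P" "v \<in> P"
  shows "abs_orthogonal A u v \<longleftrightarrow> A (u - v) = u + v"
  using assms by (simp add: abs_orthogonal_def abs_of_pos)

lemma pos_of_abs_diff_eq_add:
  assumes "A (u - v) = u + v"
  shows "u \<in> P" "v \<in> P"
proof -
  have "2 *\<^sub>R u \<in> P"
    using abs_plus_mem[of "u - v"] assms by (simp add: scaleR_2)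
  from cone_scaleR[OF this, of "1/2"] show "u \<in> P" by simp
  have "2 *\<^sub>R v \<in> P"
    using abs_minus_mem[of "u - v"] assms by (simp add: scaleR_2)
  from cone_scaleR[OF this, of "1/2"] show "v \<in> P" by simp
qed

end

end

theory Submission
  imports Defs
begin

text \<open>On the cone, orthogonality is biadditive in the strong sense that \<open>a + b \<perp> c + d\<close> holds if
  and only if each of \<open>a, b\<close> is orthogonal to each of \<open>c, d\<close> (lemma
  \<open>orthogonal_add_add_iff\<close>): one direction is the heredity axiom \<open>abs_orth_le\<close>, the other is
  \<open>abs_orth_plus\<close>. All three statements then reduce to orthogonality relations between
  the four parts \<open>u\<^sup>+, u\<^sup>-, v\<^sup>+, v\<^sup>-\<close>, for which \<open>u\<^sup>+ \<perp> u\<^sup>-\<close> and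
  \<open>v\<^sup>+ \<perp> v\<^sup>-\<close> always hold:
  \<^item> \<open>u \<perp> v\<close> says \<open>u\<^sup>+ + u\<^sup>- \<perp> v\<^sup>+ + v\<^sup>-\<close>, that is, the four
    relations between a part of \<open>u\<close> and a part of \<open>v\<close>;
  \<^item> since \<open>u + v = (u\<^sup>+ + v\<^sup>+) - (u\<^sup>- + v\<^sup>-)\<close>, the equation
    \<open>\<bar>u + v\<bar> = \<bar>u\<bar> + \<bar>v\<bar>\<close> says \<open>u\<^sup>+ + v\<^sup>+ \<perp> u\<^sup>- + v\<^sup>-\<close>;
  \<^item> likewise, \<open>\<bar>u - v\<bar> = \<bar>u\<bar> + \<bar>v\<bar>\<close> says
    \<open>u\<^sup>+ + v\<^sup>- \<perp> u\<^sup>- + v\<^sup>+\<close>.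

  Together, the last two conditions amount to the pairwise orthogonality of the four parts.\<close>

context absolutely_ordered_space
begin

lemma abs_uminus: "A (- x) = A x"
  using abs_scaleR[of "-1" x] by simp

lemma abs_orthogonal_commute: "abs_orthogonal A x y \<longleftrightarrow> abs_orthogonal A y x"
  using abs_uminus[of "A x - A y"] by (simp add: abs_orthogonal_def add.commute)

lemma abs_orthogonal_summand:
  assumes "x \<in> P" "y \<in> P" "z \<in> P" "abs_orthogonal A x (y + z)"
  shows "abs_orthogonal A x y"
proof -
  have "A (x - (y + z)) = x + (y + z)"
    using assms by (simp add: abs_orthogonal_on_cone cone_add)
  then have "A (x - y) = x + y"
    by (rule abs_orth_le) (use assms in \<open>simp_all add: cone_le_def\<close>)
  then show ?thesis
    using assms by (simp add: abs_orthogonal_on_cone)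
qed

lemma orthogonal_add_iff:
  assumes "x \<in> P" "y \<in> P" "z \<in> P"
  shows "abs_orthogonal A x (y + z) \<longleftrightarrow> abs_orthogonal A x y \<and> abs_orthogonal A x z"
proof
  assume "abs_orthogonal A x (y + z)"
  then show "abs_orthogonal A x y \<and> abs_orthogonal A x z"
    using assms abs_orthogonal_summand[of x y z] abs_orthogonal_summand[of x z y]
    by (simp add: add.commute)
next
  assume "abs_orthogonal A x y \<and> abs_orthogonal A x z"
  then have "A (x - A (y + z)) = x + A (y + z)"
    using assms by (intro abs_orth_plus) (simp_all add: abs_orthogonal_on_cone)
  then show "abs_orthogonal A x (y + z)"
    using assms by (simp add: abs_orthogonal_on_cone cone_add abs_of_pos)
qed

lemma orthogonal_add_add_iff:
  assumes "a \<in> P" "b \<in> P" "c \<in> P" "d \<in> P"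
  shows "abs_orthogonal A (a + b) (c + d) \<longleftrightarrow>
    abs_orthogonal A a c \<and> abs_orthogonal A a d \<and> abs_orthogonal A b c \<and> abs_orthogonal A b d"
proof -
  have "abs_orthogonal A (a + b) (c + d) \<longleftrightarrow>
      abs_orthogonal A (c + d) a \<and> abs_orthogonal A (c + d) b"
    using assms by (simp add: orthogonal_add_iff cone_add abs_orthogonal_commute[of "a + b"])
  then show ?thesis
    using assms
    by (simp add: orthogonal_add_iff abs_orthogonal_commute[of "c + d"])
qed

lemma pos_part_mem: "pos_part A x \<in> P"
  unfolding pos_part_def by (intro cone_scaleR abs_plus_mem) simp

lemma neg_part_mem: "neg_part A x \<in> P"
  unfolding neg_part_def by (intro cone_scaleR abs_minus_mem) simp

lemma pos_part_add_neg_part: "pos_part A x + neg_part A x = A x"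
  by (simp add: pos_part_def neg_part_def algebra_simps flip: scaleR_add_left)

lemma pos_part_diff_neg_part: "pos_part A x - neg_part A x = x"
  by (simp add: pos_part_def neg_part_def algebra_simps flip: scaleR_add_left)

lemma orthogonal_pos_part_neg_part: "abs_orthogonal A (pos_part A x) (neg_part A x)"
  by (simp add: abs_orthogonal_on_cone pos_part_mem neg_part_mem pos_part_add_neg_part
      pos_part_diff_neg_part)

lemma mutually_orthogonal_four_iff:
  "mutually_orthogonal A [a, b, c, d] \<longleftrightarrow>
    abs_orthogonal A a b \<and> abs_orthogonal A c d \<and> abs_orthogonal A a c \<and>
    abs_orthogonal A a d \<and> abs_orthogonal A b c \<and> abs_orthogonal A b d"
  using abs_orthogonal_commute[of a b] abs_orthogonal_commute[of c d]
    abs_orthogonal_commute[of a c] abs_orthogonal_commute[of a d]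
    abs_orthogonal_commute[of b c] abs_orthogonal_commute[of b d]
  by (auto simp add: mutually_orthogonal_def All_less_Suc2)

lemma orthogonal_iff_parts:
  "abs_orthogonal A u v \<longleftrightarrow>
    mutually_orthogonal A [pos_part A u, neg_part A u, pos_part A v, neg_part A v]"
proof -
  have "abs_orthogonal A u v \<longleftrightarrow> abs_orthogonal A (A u) (A v)"
    by (simp add: abs_orthogonal_def abs_of_pos abs_mem)
  also have "\<dots> \<longleftrightarrow>
      abs_orthogonal A (pos_part A u + neg_part A u) (pos_part A v + neg_part A v)"
    by (simp add: pos_part_add_neg_part)
  finally show ?thesis
    by (simp add: orthogonal_add_add_iff pos_part_mem neg_part_mem mutually_orthogonal_four_iff
        orthogonal_pos_part_neg_part)
qed

lemma abs_add_eq_iff: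
  "A (u + v) = A u + A v \<longleftrightarrow>
    abs_orthogonal A (pos_part A u + pos_part A v) (neg_part A u + neg_part A v)"
proof -
  have "pos_part A u + pos_part A v - (neg_part A u + neg_part A v) = u + v"
    by (metis add_diff_add pos_part_diff_neg_part)
  moreover have "pos_part A u + pos_part A v + (neg_part A u + neg_part A v) = A u + A v"
    by (metis add.commute add.left_commute pos_part_add_neg_part)
  ultimately show ?thesis
    by (simp add: abs_orthogonal_on_cone cone_add pos_part_mem neg_part_mem)
qed

lemma pos_part_uminus: "pos_part A (- x) = neg_part A x"
  by (simp add: pos_part_def neg_part_def abs_uminus)

lemma neg_part_uminus: "neg_part A (- x) = pos_part A x"
  by (simp add: pos_part_def neg_part_def abs_uminus)

lemma abs_diff_eq_iff:
  "A (u - v) = A u + A v \<longleftrightarrow>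
    abs_orthogonal A (pos_part A u + neg_part A v) (neg_part A u + pos_part A v)"
  using abs_add_eq_iff[of u "- v"] by (simp add: abs_uminus pos_part_uminus neg_part_uminus)

lemma parts_orthogonal_iff_abs_additive:
  "mutually_orthogonal A [pos_part A u, neg_part A u, pos_part A v, neg_part A v] \<longleftrightarrow>
    A (u + v) = A u + A v \<and> A (u - v) = A u + A v"
  unfolding abs_add_eq_iff abs_diff_eq_iff mutually_orthogonal_four_iff
  using abs_orthogonal_commute[of "pos_part A v" "neg_part A u"]
    abs_orthogonal_commute[of "neg_part A v" "neg_part A u"]
    abs_orthogonal_commute[of "neg_part A v" "pos_part A v"]
  by (auto simp: orthogonal_add_add_iff pos_part_mem neg_part_mem)

end

theorem proposition2p4:
  fixes P :: "'a::real_vector set" and A :: "'a \<Rightarrow> 'a" and u v :: 'a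
  assumes "absolutely_ordered_space P A"
  shows "(abs_orthogonal A u v \<longleftrightarrow>
            mutually_orthogonal A [pos_part A u, neg_part A u, pos_part A v, neg_part A v])
       \<and> (mutually_orthogonal A [pos_part A u, neg_part A u, pos_part A v, neg_part A v] \<longleftrightarrow>
            A (u + v) = A u + A v \<and> A (u - v) = A u + A v)"
proof -
  interpret absolutely_ordered_space P A by (rule assms)
  show ?thesis
    using orthogonal_iff_parts parts_orthogonal_iff_abs_additive by blast
qed

end
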